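(* Let $k$ be a positive integer and let $(X,\|\cdot\|)$ be a real Banach space of dimension greater than one. If the mapping $x\longmapsto\|x\|^{2k}$ is a $2k$-homogeneous (scalar-valued) polynomial on $X$, then $n^{(2k-1)}(X)=0$.
   Context: For a Banach space $X$, let $S_X$ be its unit sphere, $B_X$ its closed unit ball, $X^*$ its dual, and $\Pi(X)=\{(x,x^* )\in S_X\times S_{X^*} : x^*(x)=1\}$. A continuous $m$-homogeneous polynomial from $X$ to a normed space $Y$ is a map $P:X\to Y$ of the form $P(x)=A(x,\ldots,x)$ with $A:X\times\cdots\times X\to Y$ a continuous $m$-linear map; it is scalar-valued if $Y$ is the scalar field. $\mathcal{P}(^mX;X)$ is the space of all continuous $m$-homogeneous polynomials from $X$ to $X$, normed by $\|P\|=\sup\{\|P(x)\| : x\in B_X\}$. The numerical radius of $P\in\mathcal{P}(^mX;X)$ is $v(P)=\sup\{|x^*(P(x))| : (x,x^* )\in\Pi(X)\}$. The polynomial numerical index of order $m$ of $X$ is $n^{(m)}(X)=\inf\{v(P) : P\in\mathcal{P}(^mX;X),\ \|P\|=1\}$. *)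

theory Defs
  imports "HOL-Analysis.Analysis"
begin

text \<open>
  A point of the power \<open>X\<^sup>m\<close> is an extensional family in \<open>{..<m} \<rightarrow>\<^sub>E UNIV\<close>, which is
  the carrier of the product topology used for continuity.
\<close>

definition multilinear :: "nat \<Rightarrow> ((nat \<Rightarrow> 'a::real_vector) \<Rightarrow> 'b::real_vector) \<Rightarrow> bool" where
  "multilinear m A \<longleftrightarrow>
     (\<forall>x \<in> {..<m} \<rightarrow>\<^sub>E UNIV. \<forall>i<m. linear (\<lambda>t. A (x(i := t))))"

definition continuous_multilinear ::
    "nat \<Rightarrow> ((nat \<Rightarrow> 'a::real_normed_vector) \<Rightarrow> 'b::real_normed_vector) \<Rightarrow> bool" where
  "continuous_multilinear m A \<longleftrightarrow>
     multilinear m A \<and>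
     continuous_map (product_topology (\<lambda>_. euclidean) {..<m}) euclidean A"

definition hom_polys :: "nat \<Rightarrow> ('a::real_normed_vector \<Rightarrow> 'b::real_normed_vector) set" where
  "hom_polys m = {P. \<exists>A. continuous_multilinear m A \<and> (\<forall>x. P x = A (\<lambda>i\<in>{..<m}. x))}"

definition poly_norm :: "('a::real_normed_vector \<Rightarrow> 'b::real_normed_vector) \<Rightarrow> real" where
  "poly_norm P = (SUP x\<in>cball 0 1. norm (P x))"

definition state_pairs :: "('a::real_normed_vector \<times> ('a \<Rightarrow>\<^sub>L real)) set" where
  "state_pairs = {(x, f). x \<in> sphere 0 1 \<and> f \<in> sphere 0 1 \<and> blinfun_apply f x = 1}"

definition numerical_radius :: "('a::real_normed_vector \<Rightarrow> 'a) \<Rightarrow> real" where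
  "numerical_radius P = (SUP (x, f)\<in>state_pairs. \<bar>blinfun_apply f (P x)\<bar>)"

text \<open>
  The suprema and infima are taken in \<open>real\<close>. On a nontrivial space, for
  \<open>P \<in> hom_polys m\<close> the two suprema above are over nonempty bounded sets,
  and the infimum below is over a nonempty set of nonnegative numbers.
  The space is passed as \<open>TYPE('a)\<close>.
\<close>

definition polynomial_numerical_index :: "nat \<Rightarrow> 'a::real_normed_vector itself \<Rightarrow> real" where
  "polynomial_numerical_index m _ =
     (INF P\<in>{P \<in> hom_polys m. poly_norm P = 1}. numerical_radius (P :: 'a \<Rightarrow> 'a))"

text \<open>
  The library's \<open>dim\<close> is \<open>0\<close> on infinite-dimensional spaces, so the size of a Hamel basis
  is used instead.
\<close>

definition dimension_gt_one :: "'a::real_vector itself \<Rightarrow> bool" where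
  "dimension_gt_one _ \<longleftrightarrow>
     (\<exists>B :: 'a set. independent B \<and> span B = UNIV \<and> (infinite B \<or> card B > 1))"

end

theory Submission imports Defs begin

text \<open>
  Write \<open>\<parallel>x\<parallel>\<^sup>2\<^sup>k = A(x,\<dots>,x)\<close> and let \<open>D\<^sub>v(x)\<close> be the derivative of this polynomial at \<open>x\<close> in
  direction \<open>v\<close>. It is linear in \<open>v\<close> and a \<open>(2k-1)\<close>-homogeneous polynomial in \<open>x\<close>. At a pair
  \<open>(x,f) \<in> \<Pi>(X)\<close> the function \<open>t \<mapsto> \<parallel>x + tv\<parallel>\<^sup>2\<^sup>k - (f(x + tv))\<^sup>2\<^sup>k\<close> is nonnegative and vanishes at
  \<open>t = 0\<close>, so \<open>D\<^sub>v(x) = 2k f(v)\<close>. Hence for independent \<open>a, b\<close> the polynomial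
  \<open>P(x) = D\<^sub>a(x) b - D\<^sub>b(x) a\<close> satisfies \<open>f(P(x)) = 0\<close> on \<open>\<Pi>(X)\<close>, while the coefficient of \<open>b\<close> in
  \<open>P(a)\<close> is \<open>2k\<parallel>a\<parallel>\<^sup>2\<^sup>k \<noteq> 0\<close>. The set \<open>\<Pi>(X)\<close> is nonempty without appeal to Hahn-Banach, because
  \<open>v \<mapsto> D\<^sub>v(u) / 2k\<close> is a norming functional at each unit vector \<open>u\<close>.
\<close>

section \<open>Homogeneous polynomials\<close>

lemma multilinearD:
  assumes "multilinear m A" "y \<in> {..<m} \<rightarrow>\<^sub>E UNIV" "i < m"
  shows "linear (\<lambda>t. A (y(i := t)))"
  using assms unfolding multilinear_def by blast

text \<open>The slots are rescaled one at a time, and linearity in each slot contributes one factor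
  \<open>c\<close>.\<close>

lemma multilinear_diagonal_scaleR:
  assumes A: "multilinear m A"
  shows "A (\<lambda>i\<in>{..<m}. c *\<^sub>R x) = c ^ m *\<^sub>R A (\<lambda>i\<in>{..<m}. x)"
proof -
  \<comment> \<open>In \<open>Y j\<close> the first \<open>j\<close> slots are already rescaled, so
    \<open>Y j\<close> and \<open>Y (Suc j)\<close> differ in slot \<open>j\<close> alone.\<close>
  define Y where "Y j = (\<lambda>i\<in>{..<m}. if i < j then c *\<^sub>R x else x)" for j
  have "A (Y j) = c ^ j *\<^sub>R A (\<lambda>i\<in>{..<m}. x)" if "j \<le> m" for j
    using that
  proof (induction j)
    case 0
    then show ?case by (simp add: Y_def)
  next
    case (Suc j)
    have lin: "linear (\<lambda>t. A ((Y j)(j := t)))"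
      using Suc.prems by (intro multilinearD[OF A]) (auto simp: Y_def)
    have "Y (Suc j) = (Y j)(j := c *\<^sub>R x)" "Y j = (Y j)(j := x)"
      using Suc.prems by (auto simp: Y_def fun_eq_iff)
    then have "A (Y (Suc j)) = c *\<^sub>R A (Y j)"
      using linear_scale[OF lin, of c x] by simp
    then show ?case using Suc by simp
  qed
  moreover have "Y m = (\<lambda>i\<in>{..<m}. c *\<^sub>R x)"
    by (auto simp: Y_def fun_eq_iff)
  ultimately show ?thesis by force
qed

lemma hom_polys_scaleR:
  assumes "P \<in> hom_polys m"
  shows "P (c *\<^sub>R x) = c ^ m *\<^sub>R P x"
  using assms multilinear_diagonal_scaleR
  unfolding hom_polys_def continuous_multilinear_def by fastforce

lemma continuous_on_hom_polys:
  assumes "P \<in> hom_polys m"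
  shows "continuous_on UNIV P"
proof -
  obtain A where A: "continuous_map (product_topology (\<lambda>_. euclidean) {..<m}) euclidean A"
    and P: "P = A \<circ> (\<lambda>x. \<lambda>i\<in>{..<m}. x)"
    using assms unfolding hom_polys_def continuous_multilinear_def by (auto simp: fun_eq_iff)
  have "continuous_map euclidean (product_topology (\<lambda>_. euclidean) {..<m}) (\<lambda>x. \<lambda>i\<in>{..<m}. x)"
    by (auto simp: continuous_map_componentwise)
  then show ?thesis
    using continuous_map_compose[OF _ A] unfolding P by fastforce
qed

text \<open>Continuity at 0 bounds \<open>P\<close> on a small ball, and homogeneity carries the
  bound over to the unit ball. This makes the supremum in \<open>poly_norm\<close> a genuine
  one.\<close>

lemma hom_polys_bounded:
  assumes P: "P \<in> hom_polys m"
  shows "\<exists>C. \<forall>x\<in>cball 0 1. norm (P x) \<le> C"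
proof -
  obtain d where d: "d > 0" "\<And>x. dist x 0 < d \<Longrightarrow> dist (P x) (P 0) < 1"
    using continuous_on_hom_polys[OF P] unfolding continuous_on_iff
    by (metis UNIV_I zero_less_one)
  \<comment> \<open>Half of \<open>d\<close>, so that points of the closed ball of radius
    \<open>r\<close> satisfy the strict inequality in the choice of \<open>d\<close>.\<close>
  define r where "r = d / 2"
  have r: "r > 0" "r < d" using d(1) by (auto simp: r_def)
  have "norm (P x) \<le> (1 + norm (P 0)) / r ^ m" if x: "x \<in> cball 0 1" for x
  proof -
    have "r * norm x \<le> r" using x r by (simp add: mult_left_le)
    then have "r * norm x < d" using r(2) by (rule le_less_trans)
    then have "dist (r *\<^sub>R x) 0 < d" using r(1) by simp
    then have "norm (P (r *\<^sub>R x)) \<le> 1 + norm (P 0)"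
      using d(2)[of "r *\<^sub>R x"] norm_triangle_sub[of "P (r *\<^sub>R x)" "P 0"] by (simp add: dist_norm)
    then show ?thesis
      using r by (simp add: hom_polys_scaleR[OF P] field_simps)
  qed
  then show ?thesis by blast
qed

lemma norm_le_poly_norm:
  assumes "P \<in> hom_polys m" "norm x \<le> 1"
  shows "norm (P x) \<le> poly_norm P"
  unfolding poly_norm_def using assms hom_polys_bounded[OF assms(1)]
  by (intro cSUP_upper) (auto simp: bdd_above_def)

lemma poly_norm_pos:
  assumes P: "P \<in> hom_polys m" and x: "P x \<noteq> 0"
  shows "poly_norm P > 0"
proof -
  define r where "r = 1 / (1 + norm x)"
  have r: "r > 0" by (simp add: r_def add_pos_nonneg)
  have "norm (r *\<^sub>R x) \<le> 1"
    using norm_ge_zero[of x] by (simp add: r_def divide_le_eq not_less)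
  then have "norm (P (r *\<^sub>R x)) \<le> poly_norm P" by (rule norm_le_poly_norm[OF P])
  moreover have "norm (P (r *\<^sub>R x)) > 0"
    using x r by (simp add: hom_polys_scaleR[OF P])
  ultimately show ?thesis by linarith
qed

text \<open>Covers negation, rescaling, and the passage from a scalar polynomial to a multiple of a
  fixed vector.\<close>

lemma hom_polys_bounded_linear:
  assumes P: "P \<in> hom_polys m" and L: "bounded_linear L"
  shows "(\<lambda>x. L (P x)) \<in> hom_polys m"
proof -
  obtain A where A: "multilinear m A"
      "continuous_map (product_topology (\<lambda>_. euclidean) {..<m}) euclidean A"
    and PA: "\<And>x. P x = A (\<lambda>i\<in>{..<m}. x)"
    using P unfolding hom_polys_def continuous_multilinear_def by auto
  have "continuous_map euclidean euclidean L"
    unfolding continuous_map_iff_continuous2 by (rule linear_continuous_on[OF L])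
  from continuous_map_compose[OF A(2) this]
  have "continuous_map (product_topology (\<lambda>_. euclidean) {..<m}) euclidean (\<lambda>y. L (A y))"
    unfolding o_def .
  moreover have "multilinear m (\<lambda>y. L (A y))"
    unfolding multilinear_def
  proof (intro ballI allI impI)
    fix y :: "nat \<Rightarrow> 'a" and i
    assume "y \<in> {..<m} \<rightarrow>\<^sub>E UNIV" "i < m"
    from linear_compose[OF multilinearD[OF A(1) this] bounded_linear.linear[OF L]]
    show "linear (\<lambda>t. L (A (y(i := t))))" by (simp add: o_def)
  qed
  ultimately show ?thesis
    unfolding hom_polys_def continuous_multilinear_def using PA by force
qed

lemma hom_polys_sum:
  assumes fin: "finite I" and P: "\<And>i. i \<in> I \<Longrightarrow> P i \<in> hom_polys m"
  shows "(\<lambda>x. \<Sum>i\<in>I. P i x) \<in> hom_polys m"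
proof -
  have "\<forall>i\<in>I. \<exists>A. continuous_multilinear m A \<and> (\<forall>x. P i x = A (\<lambda>j\<in>{..<m}. x))"
    using P by (simp add: hom_polys_def)
  then obtain A where A: "\<And>i. i \<in> I \<Longrightarrow> continuous_multilinear m (A i)"
    and PA: "\<And>i x. i \<in> I \<Longrightarrow> P i x = A i (\<lambda>j\<in>{..<m}. x)"
    by metis
  have "multilinear m (\<lambda>y. \<Sum>i\<in>I. A i y)"
    using A unfolding continuous_multilinear_def multilinear_def
    by (auto intro!: linear_compose_sum)
  moreover have "continuous_map (product_topology (\<lambda>_. euclidean) {..<m}) euclidean (\<lambda>y. \<Sum>i\<in>I. A i y)"
    using A fin unfolding continuous_multilinear_def by (intro continuous_map_sum) auto
  ultimately show ?thesis
    unfolding hom_polys_def continuous_multilinear_def using PA by fastforce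
qed

lemma hom_polys_diff:
  assumes "P \<in> hom_polys m" "Q \<in> hom_polys m"
  shows "(\<lambda>x. P x - Q x) \<in> hom_polys m"
proof -
  have "(\<lambda>x. - Q x) \<in> hom_polys m"
    by (rule hom_polys_bounded_linear[OF assms(2) bounded_linear_minus[OF bounded_linear_ident]])
  \<comment> \<open>The difference is treated as a sum of two terms indexed by
    \<open>bool\<close>.\<close>
  then have "(if b then P else (\<lambda>x. - Q x)) \<in> hom_polys m" for b
    using assms(1) by simp
  then have "(\<lambda>x. \<Sum>b\<in>UNIV. (if b then P else (\<lambda>x. - Q x)) x) \<in> hom_polys m"
    by (rule hom_polys_sum[OF finite])
  then show ?thesis by (simp add: UNIV_bool)
qed

lemma continuous_multilinear_slot:
  assumes A: "continuous_multilinear (Suc n) A" and i: "i < Suc n"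
  shows "(\<lambda>x. A ((\<lambda>j\<in>{..<Suc n}. x)(i := v))) \<in> hom_polys n"
proof -
  \<comment> \<open>\<open>ins\<close> places \<open>v\<close> at position \<open>i\<close> and
    shifts the later coordinates up by one.\<close>
  define ins where
    "ins y = (\<lambda>j\<in>{..<Suc n}. if j < i then y j else if j = i then v else y (j - 1))"
    for y :: "nat \<Rightarrow> 'a"
  have "multilinear n (\<lambda>y. A (ins y))"
    unfolding multilinear_def
  proof (intro ballI allI impI)
    fix y :: "nat \<Rightarrow> 'a" and j
    assume j: "j < n"
    \<comment> \<open>The position at which coordinate \<open>j\<close> of \<open>y\<close> lands in
      \<open>ins y\<close>.\<close>
    define j' where "j' = (if j < i then j else Suc j)"
    have "ins (y(j := t)) = (ins y)(j' := t)" for t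
      using i j by (auto simp: ins_def j'_def fun_eq_iff)
    moreover have "linear (\<lambda>t. A ((ins y)(j' := t)))"
    proof (rule multilinearD)
      show "multilinear (Suc n) A" using A by (simp add: continuous_multilinear_def)
      show "ins y \<in> {..<Suc n} \<rightarrow>\<^sub>E UNIV" by (simp add: ins_def restrict_PiE_iff)
      show "j' < Suc n" using j by (simp add: j'_def)
    qed
    ultimately show "linear (\<lambda>t. A (ins (y(j := t))))" by simp
  qed
  moreover have "continuous_map (product_topology (\<lambda>_. euclidean) {..<n}) euclidean (\<lambda>y. A (ins y))"
  proof -
    have "continuous_map (product_topology (\<lambda>_. euclidean) {..<n})
        (product_topology (\<lambda>_. euclidean) {..<Suc n}) ins"
      unfolding continuous_map_componentwise
    proof (intro conjI ballI)
      fix j assume j: "j \<in> {..<Suc n}"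
      have "continuous_map (product_topology (\<lambda>_. euclidean) {..<n}) euclidean (\<lambda>y::nat\<Rightarrow>'a. y j)"
        if "j < i" using that i by (intro continuous_map_product_projection) auto
      moreover have "continuous_map (product_topology (\<lambda>_. euclidean) {..<n}) euclidean (\<lambda>y::nat\<Rightarrow>'a. y (j - 1))"
        if "j > i" using that j by (intro continuous_map_product_projection) auto
      ultimately show "continuous_map (product_topology (\<lambda>_. euclidean) {..<n}) euclidean (\<lambda>y. ins y j)"
        using j by (cases j i rule: linorder_cases) (auto simp: ins_def)
    qed (auto simp: ins_def)
    then show ?thesis
      using A continuous_map_compose unfolding continuous_multilinear_def o_def by blast
  qed
  moreover have "(\<lambda>j\<in>{..<Suc n}. x)(i := v) = ins (\<lambda>j\<in>{..<n}. x)" for x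
    using i by (auto simp: ins_def fun_eq_iff)
  ultimately show ?thesis
    unfolding hom_polys_def continuous_multilinear_def by auto
qed

section \<open>Directional derivatives on the diagonal\<close>

text \<open>The Leibniz rule for \<open>A(x,...,x)\<close> in direction \<open>v\<close>. Since
  \<open>A\<close> may fail to be symmetric, all slots are summed instead of taking \<open>n\<close>
  times one of them.\<close>

definition diagonal_derivative ::
    "nat \<Rightarrow> ((nat \<Rightarrow> 'a::real_vector) \<Rightarrow> 'b::real_vector) \<Rightarrow> 'a \<Rightarrow> 'a \<Rightarrow> 'b" where
  "diagonal_derivative n A v x = (\<Sum>i<n. A ((\<lambda>j\<in>{..<n}. x)(i := v)))"

lemma diagonal_derivative_hom_polys:
  assumes "continuous_multilinear (Suc n) A"
  shows "diagonal_derivative (Suc n) A v \<in> hom_polys n"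
  unfolding diagonal_derivative_def[abs_def]
  using assms by (intro hom_polys_sum continuous_multilinear_slot) auto

lemma linear_diagonal_derivative:
  assumes "multilinear n A"
  shows "linear (\<lambda>v. diagonal_derivative n A v x)"
  unfolding diagonal_derivative_def
  by (intro linear_compose_sum ballI multilinearD[OF assms]) (simp_all add: restrict_PiE_iff)

text \<open>Euler's identity for homogeneous functions.\<close>

lemma diagonal_derivative_self:
  "diagonal_derivative n A x x = of_nat n *\<^sub>R A (\<lambda>j\<in>{..<n}. x)"
proof -
  have "(\<lambda>j\<in>{..<n}. x)(i := x) = (\<lambda>j\<in>{..<n}. x)" if "i < n" for i
    using that by (auto simp: fun_eq_iff)
  then show ?thesis by (simp add: diagonal_derivative_def sum_constant_scaleR)
qed

text \<open>Caratheodory's criterion: the increment equals \<open>G t * t\<close> exactly, with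
  \<open>G\<close> continuous at 0.\<close>

lemma has_real_derivative_diagonal:
  fixes A :: "(nat \<Rightarrow> 'a::real_normed_vector) \<Rightarrow> real"
  assumes A: "continuous_multilinear n A"
  shows "((\<lambda>t. A (\<lambda>j\<in>{..<n}. x + t *\<^sub>R v)) has_real_derivative diagonal_derivative n A v x) (at 0)"
proof -
  \<comment> \<open>\<open>Y i t\<close> has the moved point in its first \<open>i\<close> slots and
    \<open>x\<close> in the others; the increment telescopes along these families.\<close>
  define Y where "Y i t = (\<lambda>j\<in>{..<n}. if j < i then x + t *\<^sub>R v else x)" for i and t :: real
  define G where "G t = (\<Sum>i<n. A ((Y i t)(i := v)))" for t
  have step: "A (Y (Suc i) t) - A (Y i t) = t * A ((Y i t)(i := v))" if i: "i < n" for i t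
  proof -
    have lin: "linear (\<lambda>s. A ((Y i t)(i := s)))"
      using A i by (intro multilinearD[of n])
        (auto simp: continuous_multilinear_def Y_def restrict_PiE_iff simp del: restrict_apply)
    have "Y (Suc i) t = (Y i t)(i := x + t *\<^sub>R v)" "Y i t = (Y i t)(i := x)"
      using i by (auto simp: Y_def fun_eq_iff)
    then show ?thesis
      using linear_add[OF lin, of x "t *\<^sub>R v"] linear_scale[OF lin, of t v] by simp
  qed
  have quot: "A (\<lambda>j\<in>{..<n}. x + t *\<^sub>R v) - A (\<lambda>j\<in>{..<n}. x) = G t * t" for t
  proof -
    have "Y n t = (\<lambda>j\<in>{..<n}. x + t *\<^sub>R v)" "Y 0 t = (\<lambda>j\<in>{..<n}. x)"
      by (auto simp: Y_def fun_eq_iff)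
    then have "A (\<lambda>j\<in>{..<n}. x + t *\<^sub>R v) - A (\<lambda>j\<in>{..<n}. x)
        = (\<Sum>i<n. A (Y (Suc i) t) - A (Y i t))"
      using sum_lessThan_telescope[of "\<lambda>i. A (Y i t)" n] by simp
    also have "\<dots> = G t * t"
      by (simp add: step G_def sum_distrib_left mult.commute)
    finally show ?thesis .
  qed
  have "continuous_on UNIV (\<lambda>t. A ((Y i t)(i := v)))" if i: "i < n" for i
  proof -
    have "continuous_map euclidean euclidean (\<lambda>t. ((Y i t)(i := v)) j)" if "j < n" for j
      using that by (cases "j < i") (auto simp: Y_def intro!: continuous_intros)
    then have "continuous_map euclidean (product_topology (\<lambda>_. euclidean) {..<n}) (\<lambda>t. (Y i t)(i := v))"
      using i unfolding continuous_map_componentwise by (auto simp: Y_def extensional_def)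
    then show ?thesis
      using A continuous_map_compose unfolding continuous_multilinear_def o_def
        continuous_map_iff_continuous2[symmetric] by blast
  qed
  then have "isCont G 0"
    unfolding G_def by (intro continuous_intros) (auto simp: continuous_on_eq_continuous_at)
  moreover have "G 0 = diagonal_derivative n A v x"
  proof -
    have "Y i 0 = (\<lambda>j\<in>{..<n}. x)" for i by (auto simp: Y_def fun_eq_iff)
    then show ?thesis by (simp add: G_def diagonal_derivative_def)
  qed
  ultimately show ?thesis
    unfolding CARAT_DERIV by (intro exI[of _ G]) (simp add: quot)
qed

text \<open>Otherwise \<open>f - g\<close>, which vanishes at \<open>a\<close>, would be positive
  just to the right of \<open>a\<close>.\<close>

lemma DERIV_le_of_le_right:
  fixes f g :: "real \<Rightarrow> real"
  assumes f: "(f has_real_derivative f') (at a)" and g: "(g has_real_derivative g') (at a)"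
    and eq: "f a = g a" and le: "\<And>t. t > a \<Longrightarrow> f t \<le> g t"
  shows "f' \<le> g'"
proof (rule ccontr)
  assume "\<not> f' \<le> g'"
  then obtain d where d: "d > 0" "\<And>h. 0 < h \<Longrightarrow> h < d \<Longrightarrow> f a - g a < f (a + h) - g (a + h)"
    using DERIV_pos_inc_right[OF DERIV_diff[OF f g]] by fastforce
  then show False
    using d(2)[of "d / 2"] eq le[of "a + d / 2"] by fastforce
qed

section \<open>Norms whose power is a polynomial\<close>

context
  fixes k :: nat and A :: "(nat \<Rightarrow> 'a::real_normed_vector) \<Rightarrow> real"
  assumes k: "k > 0" and A: "continuous_multilinear (2 * k) A"
    and norm_A: "\<And>x. norm x ^ (2 * k) = A (\<lambda>i\<in>{..<2 * k}. x)"
begin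

lemma norm_power_DERIV:
  "((\<lambda>t. norm (x + t *\<^sub>R v) ^ (2 * k)) has_real_derivative diagonal_derivative (2 * k) A v x) (at 0)"
  unfolding norm_A by (rule has_real_derivative_diagonal[OF A])

lemma affine_power_DERIV:
  "((\<lambda>t. (1 + t * c) ^ (2 * k)) has_real_derivative 2 * real k * c) (at 0)"
  by (auto intro!: derivative_eq_intros)

lemma state_pairs_diagonal_derivative:
  assumes "(x, f) \<in> state_pairs"
  shows "diagonal_derivative (2 * k) A v x = 2 * real k * blinfun_apply f v"
proof -
  have x: "norm x = 1" "norm f = 1" "blinfun_apply f x = 1"
    using assms by (auto simp: state_pairs_def)
  let ?h = "\<lambda>t. norm (x + t *\<^sub>R v) ^ (2 * k) - (1 + t * blinfun_apply f v) ^ (2 * k)"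
  have "?h t \<ge> 0" for t
  proof -
    have "\<bar>1 + t * blinfun_apply f v\<bar> \<le> norm (x + t *\<^sub>R v)"
      using norm_blinfun[of f "x + t *\<^sub>R v"] x by (simp add: blinfun.add_right blinfun.scaleR_right)
    then have "\<bar>1 + t * blinfun_apply f v\<bar> ^ (2 * k) \<le> norm (x + t *\<^sub>R v) ^ (2 * k)"
      by (intro power_mono) auto
    then show ?thesis by (simp add: power_even_abs)
  qed
  then have "\<forall>t. \<bar>0 - t\<bar> < 1 \<longrightarrow> ?h 0 \<le> ?h t"
    using x by simp
  then have "diagonal_derivative (2 * k) A v x - 2 * real k * blinfun_apply f v = 0"
    by (intro DERIV_local_min[OF DERIV_diff[OF norm_power_DERIV affine_power_DERIV] zero_less_one])
  then show ?thesis by simp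
qed

text \<open>The triangle inequality compares two functions of \<open>t > 0\<close> that agree at 0;
  using \<open>-v\<close> as well gives the absolute value.\<close>

lemma diagonal_derivative_le:
  assumes u: "norm u = 1"
  shows "\<bar>diagonal_derivative (2 * k) A v u\<bar> \<le> 2 * real k * norm v"
proof -
  have le: "diagonal_derivative (2 * k) A w u \<le> 2 * real k * norm w" for w
  proof (rule DERIV_le_of_le_right[OF norm_power_DERIV affine_power_DERIV])
    fix t :: real
    assume "0 < t"
    then have "norm (u + t *\<^sub>R w) \<le> 1 + t * norm w"
      using norm_triangle_ineq[of u "t *\<^sub>R w"] u by simp
    then show "norm (u + t *\<^sub>R w) ^ (2 * k) \<le> (1 + t * norm w) ^ (2 * k)"
      by (intro power_mono) auto
  qed (simp add: u)
  have "diagonal_derivative (2 * k) A (- v) u = - diagonal_derivative (2 * k) A v u"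
    using A by (intro linear_neg linear_diagonal_derivative) (simp add: continuous_multilinear_def)
  then show ?thesis using le[of v] le[of "- v"] by simp
qed

lemma norming_functional_exists:
  fixes u :: 'a
  assumes u: "norm u = 1"
  shows "\<exists>f. (u, f) \<in> state_pairs"
proof -
  define F where "F v = diagonal_derivative (2 * k) A v u / (2 * real k)" for v
  have bound: "\<bar>F v\<bar> \<le> norm v" for v
    using diagonal_derivative_le[OF u, of v] k by (simp add: F_def field_simps)
  have lin: "linear (\<lambda>v. diagonal_derivative (2 * k) A v u)"
    using A by (intro linear_diagonal_derivative) (simp add: continuous_multilinear_def)
  have "bounded_linear F"
    using bound linear_add[OF lin] linear_scale[OF lin]
    by (intro bounded_linear_intro[of _ 1]) (auto simp: F_def add_divide_distrib)
  then have app: "blinfun_apply (Blinfun F) = F" by (rule bounded_linear_Blinfun_apply)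
  \<comment> \<open>By Euler's identity the derivative of the power at \<open>u\<close> along
    \<open>u\<close> is \<open>2 * k\<close>, which the denominator in \<open>F\<close>
    cancels.\<close>
  have Fu: "F u = 1"
    using k u by (simp add: F_def diagonal_derivative_self norm_A[symmetric])
  have "norm (Blinfun F) \<le> 1"
    by (rule norm_blinfun_bound) (auto simp: app bound)
  moreover have "1 \<le> norm (Blinfun F)"
    using norm_blinfun[of "Blinfun F" u] by (simp add: app Fu u)
  ultimately have "(u, Blinfun F) \<in> state_pairs"
    by (simp add: state_pairs_def app Fu u)
  then show ?thesis by blast
qed

end

section \<open>The polynomial numerical index\<close>

text \<open>One state pair gives a nonnegative value below the supremum; the bound by
  \<open>poly_norm P\<close> makes that supremum meaningful.\<close>

lemma numerical_radius_nonneg: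
  fixes P :: "'a::real_normed_vector \<Rightarrow> 'a"
  assumes P: "P \<in> hom_polys m" and ne: "(state_pairs :: ('a \<times> ('a \<Rightarrow>\<^sub>L real)) set) \<noteq> {}"
  shows "numerical_radius P \<ge> 0"
proof -
  obtain p :: "'a \<times> ('a \<Rightarrow>\<^sub>L real)" where p: "p \<in> state_pairs" using ne by blast
  have bound: "\<bar>blinfun_apply f (P x)\<bar> \<le> poly_norm P" if "(x, f) \<in> state_pairs" for x f
    using that norm_blinfun[of f "P x"] norm_le_poly_norm[OF P, of x]
    by (simp add: state_pairs_def)
  have "bdd_above ((\<lambda>(x, f). \<bar>blinfun_apply f (P x)\<bar>) ` state_pairs)"
    using bound by (intro bdd_aboveI2[of _ _ "poly_norm P"]) auto
  from cSUP_upper[OF p this] show ?thesis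
    unfolding numerical_radius_def by (auto simp: case_prod_unfold elim: order_trans[rotated])
qed

text \<open>After normalisation \<open>P\<close> competes in the infimum with radius 0, and no
  competitor has a negative radius.\<close>

lemma polynomial_numerical_index_eq_0:
  fixes P :: "'a::real_normed_vector \<Rightarrow> 'a"
  assumes P: "P \<in> hom_polys m" and nz: "P a \<noteq> 0"
    and ne: "(state_pairs :: ('a \<times> ('a \<Rightarrow>\<^sub>L real)) set) \<noteq> {}"
    and zero: "\<And>x f. (x, f) \<in> state_pairs \<Longrightarrow> blinfun_apply f (P x) = 0"
  shows "polynomial_numerical_index m TYPE('a) = 0"
proof -
  define s where "s = poly_norm P"
  have s: "s > 0" unfolding s_def by (rule poly_norm_pos[OF P nz])
  define Q where "Q x = (1 / s) *\<^sub>R P x" for x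
  have Q: "Q \<in> hom_polys m"
    unfolding Q_def[abs_def]
    by (rule hom_polys_bounded_linear[OF P bounded_linear_scaleR_right])
  have PQ: "norm (P x) = s * norm (Q x)" for x
    using s by (simp add: Q_def)
  have "poly_norm Q \<le> 1"
    unfolding poly_norm_def using s norm_le_poly_norm[OF P]
    by (intro cSUP_least) (auto simp: Q_def s_def divide_le_eq)
  moreover have "s \<le> s * poly_norm Q"
  proof -
    have "poly_norm P \<le> s * poly_norm Q"
      unfolding poly_norm_def[of P]
      using s norm_le_poly_norm[OF Q] by (intro cSUP_least) (auto simp: PQ)
    then show ?thesis by (simp add: s_def)
  qed
  ultimately have "poly_norm Q = 1"
    using s by simp
  moreover have "numerical_radius Q = 0"
  proof -
    \<comment> \<open>Nonemptiness of \<open>state_pairs\<close> makes the image \<open>{0}\<close>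
      and not the empty set.\<close>
    have "(\<lambda>(x, f). \<bar>blinfun_apply f (Q x)\<bar>) ` state_pairs = {0}"
      using ne zero by (force simp: Q_def blinfun.scaleR_right)
    then show ?thesis by (simp add: numerical_radius_def)
  qed
  ultimately show ?thesis
    unfolding polynomial_numerical_index_def
    using Q numerical_radius_nonneg[OF _ ne]
    by (intro cInf_eq_minimum) (auto intro!: image_eqI[of _ _ Q])
qed

lemma dimension_gt_one_obtain:
  assumes "dimension_gt_one TYPE('a::real_vector)"
  obtains a b :: "'a::real_vector" where "a \<noteq> 0" "b \<notin> span {a}"
proof -
  obtain B :: "'a set" where B: "independent B" "infinite B \<or> card B > 1"
    using assms unfolding dimension_gt_one_def by auto
  obtain a where a: "a \<in> B"
    using B(2) by fastforce
  obtain b where b: "b \<in> B" "b \<noteq> a"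
  proof (cases "B \<subseteq> {a}")
    case True
    then have "finite B" "card B \<le> 1"
      using finite_subset card_mono[of "{a}" B] by auto
    then show ?thesis using B(2) by simp
  qed (use that in blast)
  have "a \<noteq> 0" using B(1) a dependent_zero by blast
  moreover have "b \<notin> span {a}"
  proof
    assume "b \<in> span {a}"
    then have "b \<in> span (B - {b})"
      using span_mono[of "{a}" "B - {b}"] a b by auto
    then show False using B(1) b unfolding dependent_def by blast
  qed
  ultimately show ?thesis by (rule that)
qed

theorem proposition2p5:
  fixes k :: nat
  assumes "k > 0"
    and "dimension_gt_one TYPE('a::banach)"
    and "(\<lambda>x::'a. norm x ^ (2 * k)) \<in> hom_polys (2 * k)"
  shows "polynomial_numerical_index (2 * k - 1) TYPE('a) = 0"
proof -
  obtain A :: "(nat \<Rightarrow> 'a) \<Rightarrow> real" where A: "continuous_multilinear (2 * k) A"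
    and norm_A: "\<And>x. norm x ^ (2 * k) = A (\<lambda>i\<in>{..<2 * k}. x)"
    using assms(3) unfolding hom_polys_def by auto
  obtain a b :: 'a where a: "a \<noteq> 0" and b: "b \<notin> span {a}"
    by (rule dimension_gt_one_obtain[OF assms(2)])
  define D where "D = diagonal_derivative (2 * k) A"
  define P where "P x = D a x *\<^sub>R b - D b x *\<^sub>R a" for x
  have "D v \<in> hom_polys (2 * k - 1)" for v
    \<comment> \<open>Here \<open>k > 0\<close> gives
      \<open>Suc (2 * k - 1) = 2 * k\<close>.\<close>
    using diagonal_derivative_hom_polys[of "2 * k - 1" A v] A assms(1) by (simp add: D_def)
  then have "P \<in> hom_polys (2 * k - 1)"
    unfolding P_def[abs_def]
    by (intro hom_polys_diff hom_polys_bounded_linear[OF _ bounded_linear_scaleR_left])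
  moreover have "P a \<noteq> 0"
  proof
    assume "P a = 0"
    \<comment> \<open>If \<open>P a\<close> vanishes, then \<open>D a a *\<^sub>R b\<close> equals
      \<open>D b a *\<^sub>R a\<close>.\<close>
    then have "D a a *\<^sub>R b \<in> span {a}"
      by (simp add: P_def span_mul span_base)
    moreover have "D a a \<noteq> 0"
      using a assms(1) by (simp add: D_def diagonal_derivative_self norm_A[symmetric])
    ultimately have "b \<in> span {a}"
      using span_mul[of "D a a *\<^sub>R b" "{a}" "inverse (D a a)"] by simp
    then show False using b by contradiction
  qed
  moreover have "\<exists>f. (sgn a, f) \<in> state_pairs"
    using a by (intro norming_functional_exists[OF assms(1) A norm_A]) (simp add: norm_sgn)
  then have "(state_pairs :: ('a \<times> ('a \<Rightarrow>\<^sub>L real)) set) \<noteq> {}" by blast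
  \<comment> \<open>On state pairs \<open>D v x\<close> is \<open>2 * k * f v\<close>, so the two
    terms of \<open>f (P x)\<close> are both \<open>2 * k * f a * f b\<close> and cancel.\<close>
  moreover have "blinfun_apply f (P x) = 0" if "(x, f) \<in> state_pairs" for x f
    using state_pairs_diagonal_derivative[OF assms(1) A norm_A that]
    by (simp add: P_def D_def blinfun.diff_right blinfun.scaleR_right)
  ultimately show ?thesis by (rule polynomial_numerical_index_eq_0)
qed

end
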